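(* Let $p$ be a positive integer, let $\nu$ be any Borel probability measure on $\mathbb{S}^{p-1}$, and let $\mu_0$ denote the uniform distribution on $\mathbb{S}^{p-1}$. Suppose $X_1, Y_1$ are drawn independently from $\nu$, and $X, Y$ are drawn independently from $\mu_0$. If $X_1^\top Y_1$ and $X^\top Y$ have the same distribution, then $\nu=\mu_0$.
   Context: $\mathbb{S}^{p-1}=\{x\in\mathbb{R}^p:\|x\|_2=1\}$ is the unit sphere; the uniform distribution is the unique rotation-invariant Borel probability measure on it. *)

theory Defs
  imports "HOL-Probability.Probability"
begin

abbreviation sphere_borel :: "(real ^ 'p) measure" where
  "sphere_borel \<equiv> restrict_space borel (sphere 0 1)"

text \<open>
  Rotations are all orthogonal maps, reflections included. For \<^term>\<open>CARD('p) \<ge> 2\<close> the proper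
  rotations already determine the same measure, but on the sphere \<open>{-1, 1}\<close> of the line the only
  proper rotation is the identity, under which every measure is invariant.
\<close>

definition uniform_on_sphere :: "(real ^ 'p) measure \<Rightarrow> bool" where
  "uniform_on_sphere \<mu> \<longleftrightarrow>
     prob_space \<mu> \<and> sets \<mu> = sets sphere_borel \<and>
     (\<forall>f. orthogonal_transformation f \<longrightarrow> distr \<mu> sphere_borel f = \<mu>)"

end

theory Submission
  imports Defs
begin

text \<open>
  Expanding \<open>(x \<bullet> y) ^ d\<close> into monomials turns \<open>E (X\<^sub>1 \<bullet> Y\<^sub>1) ^ d\<close> into the squared Euclidean norm of
  the vector of degree-\<open>d\<close> moments of \<open>\<nu>\<close>, and likewise for \<open>\<mu>\<^sub>0\<close>. By rotation invariance
  \<open>\<integral> (x \<bullet> y) ^ d d\<mu>\<^sub>0(y)\<close> is constant in \<open>x\<close> on the sphere, so the inner product of the two moment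
  vectors is also the squared norm of that of \<open>\<mu>\<^sub>0\<close>. Hence the difference of the moment vectors has
  norm \<open>0\<close>, and measures on a compact set with equal moments coincide by Stone-Weierstrass.
\<close>

section \<open>Measures on compact sets are determined by their moments\<close>

lemma integrable_continuous_on_compact:
  fixes f :: "'a::{second_countable_topology, t2_space} \<Rightarrow> real"
  assumes "finite_measure M" and M: "sets M = sets (restrict_space borel S)"
    and "compact S" and f: "continuous_on S f"
  shows "integrable M f"
proof -
  interpret finite_measure M by fact
  have sp: "space M = S" using sets_eq_imp_space_eq[OF M] by (simp add: space_restrict_space)
  have "bounded (f ` S)"
    using f \<open>compact S\<close> compact_continuous_image compact_imp_bounded by blast
  then obtain B where "\<And>x. x \<in> S \<Longrightarrow> norm (f x) \<le> B"
    unfolding bounded_iff by auto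
  moreover have "f \<in> borel_measurable M"
    using borel_measurable_continuous_on_restrict[OF f] measurable_cong_sets[OF M refl] by blast
  ultimately show ?thesis
    by (intro integrable_const_bound[of _ B]) (auto simp: sp)
qed

text \<open>The closed subsets of \<open>S\<close> form an intersection-stable generator of the
  trace sigma-algebra, so agreement on them suffices. The indicator of a nonempty closed
  \<open>C\<close> is the pointwise limit of the continuous functions
  \<open>max 0 (1 - n * infdist x C)\<close>, all bounded by 1, and dominated convergence carries
  equality of integrals over to \<open>C\<close>.\<close>

lemma measure_eqI_continuous_on_compact:
  fixes M N :: "'a::euclidean_space measure"
  assumes fM: "finite_measure M" and M: "sets M = sets (restrict_space borel S)"
    and fN: "finite_measure N" and N: "sets N = sets (restrict_space borel S)"
    and S: "compact S"
    and eq: "\<And>f::'a \<Rightarrow> real. continuous_on UNIV f \<Longrightarrow> integral\<^sup>L M f = integral\<^sup>L N f"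
  shows "M = N"
proof -
  have Sb: "S \<in> sets borel" using S by (simp add: compact_imp_closed)
  have closedS: "closed S" using S by (rule compact_imp_closed)
  have lim: "(\<lambda>n. \<integral>x. max 0 (1 - real n * infdist x C) \<partial>L) \<longlonglongrightarrow> measure L C"
    if L: "finite_measure L" "sets L = sets (restrict_space borel S)"
      and C: "closed C" "C \<subseteq> S" "C \<noteq> {}" for L and C :: "'a set"
  proof -
    interpret finite_measure L by fact
    have spL: "space L = S" using sets_eq_imp_space_eq[OF L(2)] by (simp add: space_restrict_space)
    have CL: "C \<in> sets L" using C Sb L(2) by (auto simp: sets_restrict_space_iff)
    have "(\<lambda>n. \<integral>x. max 0 (1 - real n * infdist x C) \<partial>L) \<longlonglongrightarrow> (\<integral>x. indicat_real C x \<partial>L)"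
    proof (rule integral_dominated_convergence[where w="\<lambda>_. 1"])
      show "(\<lambda>x. max 0 (1 - real n * infdist x C)) \<in> borel_measurable L" for n
        by (rule borel_measurable_integrable,
            rule integrable_continuous_on_compact[OF L S]) (intro continuous_intros)
      show "AE x in L. (\<lambda>n. max 0 (1 - real n * infdist x C)) \<longlonglongrightarrow> indicat_real C x"
      proof (intro AE_I2)
        fix x
        show "(\<lambda>n. max 0 (1 - real n * infdist x C)) \<longlonglongrightarrow> indicat_real C x"
        proof (cases "x \<in> C")
          case True
          then show ?thesis by simp
        next
          case False
          \<comment> \<open>Closedness of \<open>C\<close> keeps a point outside it at positive
            distance; the approximants then vanish once \<open>n\<close> reaches the reciprocal of
            that distance.\<close>
          then have p: "infdist x C > 0"
            using C by (metis in_closed_iff_infdist_zero infdist_nonneg less_eq_real_def)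
          have "\<forall>\<^sub>F n in sequentially. 1 / infdist x C \<le> real n"
            by (rule eventually_sequentiallyI[of "nat \<lceil>1 / infdist x C\<rceil>"]) linarith
          then have "\<forall>\<^sub>F n in sequentially. max 0 (1 - real n * infdist x C) = 0"
            by eventually_elim (use p in \<open>auto simp: field_simps max_def\<close>)
          with False show ?thesis by (simp add: tendsto_eventually)
        qed
      qed
      show "AE x in L. norm (max 0 (1 - real n * infdist x C)) \<le> 1" for n
        by (auto simp: infdist_nonneg)
    qed (use CL in auto)
    then show ?thesis using CL spL C by (simp add: Int_absorb1 Int_absorb2)
  qed
  have meq: "measure M C = measure N C" if C: "closed C" "C \<subseteq> S" for C
  \<comment> \<open>The empty set is treated apart because \<open>infdist x {}\<close> is 0 by
    convention, which would turn every approximant into the constant 1.\<close>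
  proof (cases "C = {}")
    case False
    have e: "(\<integral>x. max 0 (1 - real n * infdist x C) \<partial>M) = (\<integral>x. max 0 (1 - real n * infdist x C) \<partial>N)"
      for n by (rule eq) (intro continuous_intros)
    show ?thesis
      using LIMSEQ_unique[OF lim[OF fM M C False, unfolded e] lim[OF fN N C False]] .
  qed simp
  have gen: "sets (restrict_space borel S) = sigma_sets S {C. closed C \<and> C \<subseteq> S}"
  proof -
    have "sets (restrict_space borel S) = (\<lambda>A. S \<inter> A) ` sigma_sets UNIV (Collect closed)"
      by (simp add: sets_restrict_space borel_eq_closed)
    also have "\<dots> = sigma_sets S ((\<lambda>A. S \<inter> A) ` Collect closed)"
      using sigma_sets_Int[of S UNIV "Collect closed"] Sb by (simp add: borel_eq_closed)
    \<comment> \<open>Since \<open>S\<close> is closed, traces of closed sets on \<open>S\<close>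
      are again closed.\<close>
    also have "(\<lambda>A. S \<inter> A) ` Collect closed = {C. closed C \<and> C \<subseteq> S}"
      using closedS by (auto simp: image_iff)
    finally show ?thesis .
  qed
  show ?thesis
  proof (rule measure_eqI_generator_eq[where \<Omega>=S and E="{C. closed C \<and> C \<subseteq> S}" and A="\<lambda>_. S"])
    show "emeasure M C = emeasure N C" if "C \<in> {C. closed C \<and> C \<subseteq> S}" for C
      using that meq fM fN by (simp add: finite_measure.emeasure_eq_measure)
    show "emeasure M S \<noteq> \<infinity>" using fM by (simp add: finite_measure.emeasure_finite)
  qed (use closedS M N gen in \<open>auto simp: Int_stable_def\<close>)
qed

text \<open>By Stone-Weierstrass a continuous function is uniformly close on \<open>S\<close> to a
  polynomial, and a uniform error \<open>e\<close> changes an integral against a probability measure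
  by at most \<open>e\<close>.\<close>

lemma measure_eqI_real_polynomial_on_compact:
  fixes M N :: "'a::euclidean_space measure"
  assumes fM: "prob_space M" and M: "sets M = sets (restrict_space borel S)"
    and fN: "prob_space N" and N: "sets N = sets (restrict_space borel S)"
    and S: "compact S"
    and eq: "\<And>p. real_polynomial_function p \<Longrightarrow> integral\<^sup>L M p = integral\<^sup>L N p"
  shows "M = N"
proof (rule measure_eqI_continuous_on_compact[OF _ M _ N S])
  show fin: "finite_measure M" "finite_measure N"
    using fM fN by (auto simp: prob_space_def)
  fix f :: "'a \<Rightarrow> real" assume "continuous_on UNIV f"
  then have f: "continuous_on S f" by (rule continuous_on_subset) simp
  have approx: "\<bar>integral\<^sup>L L f - integral\<^sup>L L p\<bar> \<le> e"
    if L: "prob_space L" "sets L = sets (restrict_space borel S)"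
      and p: "real_polynomial_function p" "\<And>x. x \<in> S \<Longrightarrow> \<bar>f x - p x\<bar> < e"
    for L :: "'a measure" and p e
  proof -
    interpret prob_space L by fact
    have spL: "space L = S" using sets_eq_imp_space_eq[OF L(2)] by (simp add: space_restrict_space)
    have pc: "continuous_on S p"
      using p(1) by (simp add: continuous_on_polymonial_function real_polynomial_function_eq)
    have i: "integrable L f" "integrable L p"
      using integrable_continuous_on_compact[OF finite_measure_axioms L(2) S] f pc by auto
    have "\<bar>integral\<^sup>L L f - integral\<^sup>L L p\<bar> = \<bar>\<integral>x. f x - p x \<partial>L\<bar>"
      using i by simp
    also have "\<dots> \<le> (\<integral>x. \<bar>f x - p x\<bar> \<partial>L)" by (rule integral_abs_bound)
    also have "\<dots> \<le> (\<integral>x. e \<partial>L)"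
      using i p(2) by (intro integral_mono) (auto simp: spL less_imp_le)
    finally show ?thesis by (simp add: prob_space)
  qed
  have "\<bar>integral\<^sup>L M f - integral\<^sup>L N f\<bar> \<le> e" if e: "e > 0" for e
  proof -
    \<comment> \<open>The approximation error is paid once for each measure, hence
      \<open>e / 2\<close>.\<close>
    obtain p where p: "real_polynomial_function p" "\<And>x. x \<in> S \<Longrightarrow> \<bar>f x - p x\<bar> < e / 2"
      using Stone_Weierstrass_real_polynomial_function[OF S f half_gt_zero[OF e]] by metis
    show ?thesis
      using approx[OF fM M p] approx[OF fN N p] eq[OF p(1)] by linarith
  qed
  then have "\<bar>integral\<^sup>L M f - integral\<^sup>L N f\<bar> \<le> 0" by (rule field_le_epsilon) simp
  then show "integral\<^sup>L M f = integral\<^sup>L N f" by simp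
qed

text \<open>Ordered index words, rather than multi-indices, make the expansion of \<open>(x \<bullet> y) ^ d\<close>
  free of multinomial coefficients.\<close>

definition monomial :: "'n list \<Rightarrow> real ^ 'n \<Rightarrow> real" where
  "monomial is x = (\<Prod>i\<leftarrow>is. x $ i)"

lemma monomial_simps [simp]:
  "monomial [] x = 1" "monomial (i # is) x = x $ i * monomial is x"
  by (simp_all add: monomial_def)

lemma continuous_on_monomial: "continuous_on A (monomial is)"
proof (induction "is")
  case (Cons i "is")
  then have "continuous_on A (\<lambda>x. x $ i * monomial is x)" by (intro continuous_intros)
  then show ?case by simp
qed simp

lemma inner_power_eq_sum_monomial:
  fixes x y :: "real ^ 'n"
  shows "(x \<bullet> y) ^ d = (\<Sum>is | length is = d. monomial is x * monomial is y)"
proof (induction d)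
  case (Suc d)
  \<comment> \<open>Splitting off the first letter makes the sum factor into the inner product and
    the sum for degree \<open>d\<close>.\<close>
  have eq: "{is :: 'n list. length is = Suc d} = (\<lambda>(i, is). i # is) ` (UNIV \<times> {is. length is = d})"
    by (auto simp: image_iff length_Suc_conv)
  have "(\<Sum>is | length is = Suc d. monomial is x * monomial is y) =
      (\<Sum>(i, is) \<in> UNIV \<times> {is. length is = d}. (x $ i * y $ i) * (monomial is x * monomial is y))"
    unfolding eq by (subst sum.reindex) (auto simp: inj_on_def case_prod_unfold mult_ac)
  also have "\<dots> = (\<Sum>i\<in>UNIV. x $ i * y $ i) * (\<Sum>is | length is = d. monomial is x * monomial is y)"
    by (simp add: sum_product sum.cartesian_product)
  finally show ?case by (simp only: Suc [symmetric] power_Suc) (simp add: inner_vec_def)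
qed simp

text \<open>Equality of integrals is not preserved by products, so a direct induction over
  polynomial functions fails. The induction instead shows that multiplying by a polynomial preserves
  \<open>good\<close>: equality of integrals against all monomials.\<close>

lemma measure_eqI_monomial_on_compact:
  fixes M N :: "(real ^ 'n) measure"
  assumes pM: "prob_space M" and M: "sets M = sets (restrict_space borel S)"
    and pN: "prob_space N" and N: "sets N = sets (restrict_space borel S)"
    and S: "compact S"
    and eq: "\<And>is. integral\<^sup>L M (monomial is) = integral\<^sup>L N (monomial is)"
  shows "M = N"
proof (rule measure_eqI_real_polynomial_on_compact[OF pM M pN N S])
  have int: "integrable M f" "integrable N f" if "continuous_on S f" for f :: "_ \<Rightarrow> real"
    using integrable_continuous_on_compact[OF _ M S that]
      integrable_continuous_on_compact[OF _ N S that] pM pN by (auto simp: prob_space_def)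
  define good :: "(real ^ 'n \<Rightarrow> real) \<Rightarrow> bool" where
    "good h \<longleftrightarrow> continuous_on S h \<and>
       (\<forall>is. (\<integral>x. h x * monomial is x \<partial>M) = (\<integral>x. h x * monomial is x \<partial>N))" for h
  have good_int: "integrable M (\<lambda>x. h x * monomial is x)" "integrable N (\<lambda>x. h x * monomial is x)"
    if "good h" for h "is"
    using that by (auto intro!: int continuous_intros continuous_on_monomial simp: good_def)
  \<comment> \<open>Keeping \<open>h\<close> arbitrary settles the product case: first
    \<open>q\<close> is absorbed into \<open>h\<close>, then \<open>p\<close> acts on
    \<open>q * h\<close>.\<close>
  have good_mult: "good (\<lambda>x. p x * h x)" if "real_polynomial_function p" "good h" for p h
    using that
  proof (induction p arbitrary: h)
    case (linear p)
    have p: "p x = (\<Sum>i\<in>UNIV. x $ i * p (axis i 1))" for x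
    proof -
      have "p x = p (\<Sum>i\<in>UNIV. x $ i *\<^sub>R axis i 1)"
        by (subst basis_expansion[of x, unfolded scalar_mult_eq_scaleR]) simp
      also have "\<dots> = (\<Sum>i\<in>UNIV. x $ i * p (axis i 1))"
        using linear(1) by (simp add: linear_sum linear_scale bounded_linear.linear)
      finally show ?thesis .
    qed
    \<comment> \<open>A linear functional is a combination of coordinates, and multiplying by the
      coordinate \<open>i\<close> prepends the letter \<open>i\<close> to the word. This is why
      \<open>good\<close> ranges over all words.\<close>
    have *: "p x * h x * monomial is x =
        (\<Sum>i\<in>UNIV. p (axis i 1) * (h x * monomial (i # is) x))" for x "is"
      by (subst p) (simp add: sum_distrib_left sum_distrib_right mult_ac)
    have "continuous_on S (\<lambda>x. p x * h x)"
      using linear linear_continuous_on[of p S] by (auto simp: good_def intro: continuous_on_mult)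
    moreover have "(\<integral>x. p x * h x * monomial is x \<partial>M) = (\<integral>x. p x * h x * monomial is x \<partial>N)" for "is"
      unfolding * using good_int[OF linear(2)] linear(2)
      by (simp add: good_def Bochner_Integration.integral_sum del: monomial_simps)
    ultimately show ?case by (simp add: good_def)
  next
    case (const c)
    then show ?case by (auto simp: good_def mult.assoc intro!: continuous_intros)
  next
    case (add p q)
    then have "good (\<lambda>x. p x * h x)" "good (\<lambda>x. q x * h x)" by auto
    moreover from this have "continuous_on S (\<lambda>x. p x * h x + q x * h x)"
      by (auto simp: good_def intro: continuous_on_add)
    ultimately show ?case using good_int[of "\<lambda>x. p x * h x"] good_int[of "\<lambda>x. q x * h x"]
      by (simp add: good_def distrib_right)
  next
    case (mult p q)
    then have "good (\<lambda>x. p x * (q x * h x))" by auto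
    then show ?case by (simp add: mult.assoc)
  qed
  have one: "good (\<lambda>_. 1)" by (simp add: good_def eq)
  show "integral\<^sup>L M p = integral\<^sup>L N p" if "real_polynomial_function p" for p
  proof -
    have "(\<integral>x. p x * 1 * monomial [] x \<partial>M) = (\<integral>x. p x * 1 * monomial [] x \<partial>N)"
      using good_mult[OF that one] unfolding good_def by blast
    then show ?thesis by simp
  qed
qed

section \<open>Moments on the sphere\<close>

lemma finite_words: "finite {is :: 'n::finite list. length is = d}"
  using finite_lists_length_eq[of "UNIV :: 'n set" d] by simp

lemma integrable_sphere:
  fixes f :: "real ^ 'n \<Rightarrow> real"
  assumes "prob_space \<mu>" "sets \<mu> = sets sphere_borel" "continuous_on (sphere 0 1) f"
  shows "integrable \<mu> f"
  using integrable_continuous_on_compact[OF _ assms(2) _ assms(3)] assms(1)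
  by (auto simp: prob_space_def)

text \<open>The monomial expansion separates the two variables, so independence factors each
  expectation; as both factors have law \<open>\<mu>\<close>, the product is a square.\<close>

lemma inner_moment_eq_sum_squares:
  fixes X Y :: "'a \<Rightarrow> real ^ 'n"
  assumes "prob_space M"
    and ind: "prob_space.indep_var M sphere_borel X sphere_borel Y"
    and X: "distr M sphere_borel X = \<mu>" and Y: "distr M sphere_borel Y = \<mu>"
  shows "(\<integral>t. t ^ d \<partial>distr M borel (\<lambda>\<omega>. X \<omega> \<bullet> Y \<omega>)) =
    (\<Sum>is | length is = d. (integral\<^sup>L \<mu> (monomial is))\<^sup>2)"
proof -
  interpret prob_space M by fact
  have mX [measurable]: "X \<in> measurable M sphere_borel" and mY [measurable]: "Y \<in> measurable M sphere_borel"
    using ind by (auto dest: indep_var_rv1 indep_var_rv2)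
  have mXb: "X \<in> borel_measurable M" and mYb: "Y \<in> borel_measurable M"
    using mX mY by (simp_all add: measurable_restrict_space2_iff)
  have pm: "prob_space \<mu>" using prob_space_distr[OF mX] X by simp
  have sm: "sets \<mu> = sets sphere_borel" using X by auto
  have mm: "monomial is \<in> borel_measurable sphere_borel" for "is" :: "'n list"
    by (rule borel_measurable_continuous_on_restrict[OF continuous_on_monomial])
  have im: "integrable \<mu> (monomial is)" for "is" :: "'n list"
    by (rule integrable_sphere[OF pm sm continuous_on_monomial])
  have iX: "integrable M (\<lambda>\<omega>. monomial is (X \<omega>))" and iY: "integrable M (\<lambda>\<omega>. monomial is (Y \<omega>))" for "is"
    using integrable_distr_eq[OF mX mm] integrable_distr_eq[OF mY mm] im X Y by auto
  have eX: "(\<integral>\<omega>. monomial is (X \<omega>) \<partial>M) = integral\<^sup>L \<mu> (monomial is)"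
    and eY: "(\<integral>\<omega>. monomial is (Y \<omega>) \<partial>M) = integral\<^sup>L \<mu> (monomial is)" for "is"
    using integral_distr[OF mX mm] integral_distr[OF mY mm] X Y by auto
  have ind': "indep_var borel (\<lambda>\<omega>. monomial is (X \<omega>)) borel (\<lambda>\<omega>. monomial is (Y \<omega>))" for "is"
    using indep_var_compose[OF ind mm mm, of "is" "is"] by (simp add: comp_def)
  have "(\<integral>t. t ^ d \<partial>distr M borel (\<lambda>\<omega>. X \<omega> \<bullet> Y \<omega>)) = (\<integral>\<omega>. (X \<omega> \<bullet> Y \<omega>) ^ d \<partial>M)"
    using mXb mYb by (subst integral_distr) auto
  also have "\<dots> = (\<Sum>is | length is = d. \<integral>\<omega>. monomial is (X \<omega>) * monomial is (Y \<omega>) \<partial>M)"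
    unfolding inner_power_eq_sum_monomial
    by (intro Bochner_Integration.integral_sum indep_var_integrable[OF ind'] iX iY)
  also have "\<dots> = (\<Sum>is | length is = d. (integral\<^sup>L \<mu> (monomial is))\<^sup>2)"
    by (simp add: indep_var_lebesgue_integral[OF ind' iX iY] eX eY power2_eq_square)
  finally show ?thesis .
qed

text \<open>Orthogonal maps act transitively on the sphere. If \<open>f\<close> takes
  \<open>x\<close> to \<open>x'\<close>, substituting \<open>f y\<close> for \<open>y\<close>
  preserves \<open>\<mu>\<close>, and \<open>f x \<bullet> f y = x \<bullet> y\<close>.\<close>

lemma uniform_inner_moment_const:
  fixes \<mu> :: "(real ^ 'n) measure"
  assumes u: "uniform_on_sphere \<mu>" and "x \<in> sphere 0 1" "x' \<in> sphere 0 1"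
  shows "(\<integral>y. (x \<bullet> y) ^ d \<partial>\<mu>) = (\<integral>y. (x' \<bullet> y) ^ d \<partial>\<mu>)"
proof -
  obtain f where f: "orthogonal_transformation f" "f x = x'"
    using orthogonal_transformation_exists[of x x'] assms by auto
  have s: "sets \<mu> = sets sphere_borel" and df: "distr \<mu> sphere_borel f = \<mu>"
    using u f by (auto simp: uniform_on_sphere_def)
  have "f \<in> measurable sphere_borel sphere_borel"
    using f(1) by (intro measurable_restrict_space3 borel_measurable_continuous_onI
        linear_continuous_on) (auto simp: orthogonal_transformation_norm orthogonal_transformation_linear
        linear_conv_bounded_linear[symmetric])
  then have mf: "f \<in> measurable \<mu> sphere_borel" using s measurable_cong_sets by blast
  have mg: "(\<lambda>y. (x' \<bullet> y) ^ d) \<in> borel_measurable sphere_borel"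
    by (intro borel_measurable_continuous_on_restrict continuous_intros)
  have "(\<integral>y. (x' \<bullet> y) ^ d \<partial>\<mu>) = (\<integral>y. (x' \<bullet> f y) ^ d \<partial>\<mu>)"
    using integral_distr[OF mf mg] df by simp
  also have "\<dots> = (\<integral>y. (x \<bullet> y) ^ d \<partial>\<mu>)"
    using f by (simp add: orthogonal_transformation_def flip: f(2))
  finally show ?thesis by simp
qed

text \<open>The sum is the double integral of \<open>(z \<bullet> y) ^ d\<close>, whose inner
  integral over \<open>\<mu>\<close> does not depend on \<open>z\<close>. The value is therefore the
  same for every \<open>\<nu>\<close>, in particular for \<open>\<mu>\<close> itself.\<close>

lemma sum_uniform_moments_mult:
  fixes \<mu> \<nu> :: "(real ^ 'n) measure"
  assumes u: "uniform_on_sphere \<mu>" and \<nu>: "prob_space \<nu>" "sets \<nu> = sets sphere_borel"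
    and x: "x \<in> sphere 0 1"
  shows "(\<Sum>is | length is = d. integral\<^sup>L \<nu> (monomial is) * integral\<^sup>L \<mu> (monomial is)) =
    (\<integral>y. (x \<bullet> y) ^ d \<partial>\<mu>)"
proof -
  interpret \<nu>: prob_space \<nu> by fact
  have \<mu>: "prob_space \<mu>" "sets \<mu> = sets sphere_borel" using u by (auto simp: uniform_on_sphere_def)
  have sp: "space \<nu> = sphere 0 1"
    using sets_eq_imp_space_eq[OF \<nu>(2)] by (simp add: space_restrict_space)
  note i = integrable_sphere[OF \<mu> continuous_on_monomial] integrable_sphere[OF \<nu> continuous_on_monomial]
  \<comment> \<open>The expansion is a finite sum, so linearity of each integral replaces an appeal
    to Fubini.\<close>
  have "(\<Sum>is | length is = d. integral\<^sup>L \<nu> (monomial is) * integral\<^sup>L \<mu> (monomial is)) =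
      (\<integral>z. (\<Sum>is | length is = d. monomial is z * integral\<^sup>L \<mu> (monomial is)) \<partial>\<nu>)"
    using i by (simp add: Bochner_Integration.integral_sum)
  also have "\<dots> = (\<integral>z. (\<integral>y. (z \<bullet> y) ^ d \<partial>\<mu>) \<partial>\<nu>)"
    unfolding inner_power_eq_sum_monomial using i by (simp add: Bochner_Integration.integral_sum)
  also have "\<dots> = (\<integral>z. (\<integral>y. (x \<bullet> y) ^ d \<partial>\<mu>) \<partial>\<nu>)"
    by (rule Bochner_Integration.integral_cong[OF refl])
      (use x in \<open>auto simp: sp intro!: uniform_inner_moment_const[OF u]\<close>)
  finally show ?thesis by (simp add: \<nu>.prob_space)
qed

theorem proposition1:
  fixes \<nu> \<mu>\<^sub>0 :: "(real ^ 'p) measure"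
    and M :: "'a measure" and X\<^sub>1 Y\<^sub>1 :: "'a \<Rightarrow> real ^ 'p"
    and N :: "'b measure" and X Y :: "'b \<Rightarrow> real ^ 'p"
  assumes "prob_space \<nu>" and "sets \<nu> = sets sphere_borel"
    and "uniform_on_sphere \<mu>\<^sub>0"
    and "prob_space M"
    and "prob_space.indep_var M sphere_borel X\<^sub>1 sphere_borel Y\<^sub>1"
    and "distr M sphere_borel X\<^sub>1 = \<nu>" and "distr M sphere_borel Y\<^sub>1 = \<nu>"
    and "prob_space N"
    and "prob_space.indep_var N sphere_borel X sphere_borel Y"
    and "distr N sphere_borel X = \<mu>\<^sub>0" and "distr N sphere_borel Y = \<mu>\<^sub>0"
    and "distr M borel (\<lambda>\<omega>. X\<^sub>1 \<omega> \<bullet> Y\<^sub>1 \<omega>) = distr N borel (\<lambda>\<omega>. X \<omega> \<bullet> Y \<omega>)"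
  shows "\<nu> = \<mu>\<^sub>0"
proof (rule measure_eqI_monomial_on_compact[OF assms(1,2)])
  have \<mu>: "prob_space \<mu>\<^sub>0" "sets \<mu>\<^sub>0 = sets sphere_borel"
    using assms(3) by (auto simp: uniform_on_sphere_def)
  then show "prob_space \<mu>\<^sub>0" "sets \<mu>\<^sub>0 = sets sphere_borel" by auto
  show "compact (sphere 0 1 :: (real ^ 'p) set)" by simp
  fix "is" :: "'p list"
  let ?d = "length is"
  let ?a = "\<lambda>js. integral\<^sup>L \<nu> (monomial js)" and ?b = "\<lambda>js. integral\<^sup>L \<mu>\<^sub>0 (monomial js)"
  let ?W = "{js :: 'p list. length js = ?d}"
  obtain x :: "real ^ 'p" where x: "x \<in> sphere 0 1"
    using vector_choose_size[of 1] by auto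
  have "(\<Sum>js\<in>?W. (?a js)\<^sup>2) = (\<Sum>js\<in>?W. (?b js)\<^sup>2)"
    using inner_moment_eq_sum_squares[OF assms(4-7), of ?d]
      inner_moment_eq_sum_squares[OF assms(8-11), of ?d] assms(12) by simp
  \<comment> \<open>Both sides equal the same integral over \<open>\<mu>\<^sub>0\<close>: the
    mixed-moment identity is used once with \<open>\<nu>\<close> and once with
    \<open>\<mu>\<^sub>0\<close> as the other measure.\<close>
  moreover have "(\<Sum>js\<in>?W. ?a js * ?b js) = (\<Sum>js\<in>?W. (?b js)\<^sup>2)"
    using sum_uniform_moments_mult[OF assms(3,1,2) x, of ?d]
      sum_uniform_moments_mult[OF assms(3) \<mu> x, of ?d] by (simp add: power2_eq_square)
  \<comment> \<open>Expanding the square, with \<open>B\<close> the sum of the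
    \<open>(?b js)\<^sup>2\<close>, gives \<open>B - 2 * B + B\<close>.\<close>
  ultimately have "(\<Sum>js\<in>?W. (?a js - ?b js)\<^sup>2) = 0"
    by (simp add: power2_diff sum.distrib sum_subtractf mult.assoc flip: sum_distrib_left)
  then have "(?a is - ?b is)\<^sup>2 = 0"
    by (subst (asm) sum_nonneg_eq_0_iff) (auto simp: finite_words)
  then show "?a is = ?b is" by simp
qed

end
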